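(* Let $\mu$ be a probability distribution on (the vertex set of) a locally finite tree $T$ such that the weight function $M$ of $\mu$ is totally defined. Then the Direct Descent Heuristic applied to $T$ and $M$ finds a central point of $\mu$ on $T$; that is, it terminates and its output is a vertex belonging to $\mathbb{E}(\mu)$.
   Context: Let $d$ be the graph distance on $V(T)$. The weight function of $\mu$ is $M(v)=\sum_{s\in V(T)}d^2(v,s)\mu(s)$; it is totally defined if $M(v)<\infty$ for all $v$. The mean-set (set of central points) of $\mu$ is $\mathbb{E}(\mu)=\{v\in V(T)\mid M(v)\le M(u)\ \forall u\in V(T)\}$. The Direct Descent Heuristic takes as input a graph $\Gamma$ and a function $f:V(\Gamma)\to\mathbb{R}$ and proceeds as follows. (A) Choose a random (arbitrary) $v\in V(\Gamma)$. (B) If $v$ has no adjacent vertex with a smaller value of $f$, output the current $v$ and stop. (C) Otherwise replace $v$ by $u$, where $u$ is any vertex adjacent to $v$ with $f(u)<f(v)$, and go to step (B). *)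

theory Defs
  imports
    "HOL-Probability.Probability_Mass_Function"
    "Graph_Theory.Digraph_Component"
begin

text \<open>
  An undirected simple graph, finite or infinite, is a symmetric loopfree digraph without
  parallel arcs, i.e. a \<^const>\<open>pair_bidirected_digraph\<close>. In such a digraph the two orientations of
  an edge form a closed walk of length 2, which the library's \<^const>\<open>pre_digraph.cycle\<close> counts as
  a cycle; the library's \<^const>\<open>tree\<close> is therefore unsuitable for undirected graphs, and cycles are
  required to have length at least 3 here. Connected graphs are nonempty.
\<close>

definition undirected_tree :: "'a pair_pre_digraph \<Rightarrow> bool" where
  "undirected_tree G \<longleftrightarrow>
     pair_bidirected_digraph G \<and>
     Digraph_Component.connected (with_proj G) \<and>
     (\<nexists>p. pre_digraph.cycle (with_proj G) p \<and> 3 \<le> length p)"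

definition locally_finite_graph :: "'a pair_pre_digraph \<Rightarrow> bool" where
  "locally_finite_graph G \<longleftrightarrow> (\<forall>v\<in>pverts G. finite {u. (v, u) \<in> parcs G})"

text \<open>Meaningful only for vertices that are joined by a walk.\<close>

definition graph_dist :: "'a pair_pre_digraph \<Rightarrow> 'a \<Rightarrow> 'a \<Rightarrow> nat" where
  "graph_dist G u v = (LEAST n. \<exists>p. pre_digraph.awalk (with_proj G) u p v \<and> length p = n)"

definition weight_fn :: "'a pair_pre_digraph \<Rightarrow> 'a pmf \<Rightarrow> 'a \<Rightarrow> ennreal" where
  "weight_fn G \<mu> v =
     (\<Sum>\<^sub>\<infinity>s\<in>pverts G. ennreal ((real (graph_dist G v s))\<^sup>2 * pmf \<mu> s))"

definition totally_defined :: "'a pair_pre_digraph \<Rightarrow> 'a pmf \<Rightarrow> bool" where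
  "totally_defined G \<mu> \<longleftrightarrow> (\<forall>v\<in>pverts G. weight_fn G \<mu> v < \<infinity>)"

definition mean_set :: "'a pair_pre_digraph \<Rightarrow> 'a pmf \<Rightarrow> 'a set" where
  "mean_set G \<mu> = {v \<in> pverts G. \<forall>u\<in>pverts G. weight_fn G \<mu> v \<le> weight_fn G \<mu> u}"

text \<open>
  The Direct Descent Heuristic is nondeterministic, both in the initial vertex and in each move.
  It is modelled by its transition relation: a vertex without successor is one at which the
  procedure stops and outputs that vertex.
\<close>

definition descent_step :: "'a pair_pre_digraph \<Rightarrow> ('a \<Rightarrow> real) \<Rightarrow> 'a \<Rightarrow> 'a \<Rightarrow> bool" where
  "descent_step G f v u \<longleftrightarrow> (v, u) \<in> parcs G \<and> f u < f v"

definition descent_terminates :: "'a pair_pre_digraph \<Rightarrow> ('a \<Rightarrow> real) \<Rightarrow> 'a \<Rightarrow> bool" where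
  "descent_terminates G f v \<longleftrightarrow>
     (\<nexists>x :: nat \<Rightarrow> 'a. x 0 = v \<and> (\<forall>n. descent_step G f (x n) (x (Suc n))))"

definition descent_outputs :: "'a pair_pre_digraph \<Rightarrow> ('a \<Rightarrow> real) \<Rightarrow> 'a \<Rightarrow> 'a set" where
  "descent_outputs G f v = {w. (descent_step G f)\<^sup>*\<^sup>* v w \<and> (\<nexists>u. descent_step G f w u)}"

end

theory Submission
  imports Defs
begin

text \<open>
  The weight function of a tree is uniformly convex: if \<open>u\<close> and \<open>w\<close> are distinct neighbours of \<open>v\<close>,
  then \<open>M u + M w \<ge> 2 * M v + 1\<close> (\<open>weight_fn_convex\<close>). This holds because, for each vertex \<open>s\<close>, at
  most one neighbour of \<open>v\<close> fails to be farther from \<open>s\<close> than \<open>v\<close> itself: two such neighbours would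
  be joined by a walk that avoids \<open>v\<close>, and a path extracted from it would close up through \<open>v\<close> to a
  cycle. So along \<open>u, v, w\<close> the distance to \<open>s\<close> increases by 1 in one direction and decreases by at
  most 1 in the other, which makes its square convex with a constant surplus; averaging over \<open>s\<close>
  with the probabilities given by \<open>\<mu>\<close> preserves both the convexity and the surplus.

  Uniform convexity settles both claims about the heuristic. A descent never steps back to the vertex
  that it came from, so its successive changes of \<open>M\<close> grow by at least 1 with each step; they are
  negative, hence the descent is finite (\<open>uniformly_convex_descent_terminates\<close>). Where it stops, the
  first step of a path to any other vertex does not decrease \<open>M\<close>, and by convexity neither do the
  later ones, so the output is a global minimum (\<open>convex_local_min_imp_global_min\<close>).
\<close>

section \<open>Geodesics in a tree\<close>

context pair_bidirected_digraph
begin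

text \<open>
  A path from \<open>u\<close> to \<open>w\<close> extracted from the given walk has at least one arc, so together with the two
  arcs at \<open>v\<close> it gives length at least 3. This excludes the closed walks that run along one edge and
  back, which are cycles of length 2 in a symmetric digraph.
\<close>

lemma cycle_through_two_neighbours:
  assumes vu: "(v, u) \<in> parcs G" and vw: "(v, w) \<in> parcs G" and "u \<noteq> w"
    and p: "awalk u p w" and avoid: "v \<notin> set (awalk_verts u p)"
  shows "\<exists>c. cycle c \<and> 3 \<le> length c"
proof -
  define q where "q = awalk_to_apath p"
  have q: "apath u q w" unfolding q_def using p by (rule apath_awalk_to_apath)
  have sub: "set q \<subseteq> set p" unfolding q_def using p by (rule awalk_to_apath_subset)
  have qw: "awalk u q w" using q by (rule awalkI_apath)
  have "q \<noteq> []" using qw \<open>u \<noteq> w\<close> by (auto simp: awalk_Nil_iff)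
  have vq: "v \<notin> set (awalk_verts u q)"
  proof -
    have "p \<noteq> []" using \<open>q \<noteq> []\<close> sub by auto
    then have "set (awalk_verts u q) \<subseteq> set (awalk_verts u p)"
      using sub \<open>q \<noteq> []\<close> qw p set_awalk_verts_not_Nil[of u q w] set_awalk_verts_not_Nil[of u p w]
      by auto
    then show ?thesis using avoid by blast
  qed
  define c where "c = (v, u) # q @ [(w, v)]"
  have wv: "(w, v) \<in> parcs G" using vw by (rule arcs_symmetric)
  have c: "awalk v c v"
    unfolding c_def using vu wv qw by (auto simp: awalk_simps dest: in_arcsD1 in_arcsD2)
  have "awalk u (q @ [(w, v)]) v" using c unfolding c_def by (auto simp: awalk_Cons_iff)
  then have "awalk_verts u (q @ [(w, v)]) = awalk_verts u q @ [v]"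
    using qw by (auto simp: awalk_verts_append)
  then have "tl (awalk_verts v c) = awalk_verts u q @ [v]"
    by (simp add: c_def)
  then have "distinct (tl (awalk_verts v c))" using q vq by (auto simp: apath_def)
  then have "cycle c" using c unfolding cycle_def c_def by blast
  moreover have "3 \<le> length c" using \<open>q \<noteq> []\<close> by (cases q) (auto simp: c_def)
  ultimately show ?thesis by blast
qed

lemma graph_dist_le: "awalk u p v \<Longrightarrow> graph_dist G u v \<le> length p"
  unfolding graph_dist_def by (rule Least_le) blast

lemma geodesicE:
  assumes "u \<rightarrow>\<^sup>*\<^bsub>with_proj G\<^esub> v"
  obtains p where "awalk u p v" "length p = graph_dist G u v"
proof -
  have "\<exists>n p. awalk u p v \<and> length p = n" using assms by (auto simp: reachable_awalk)
  then have "\<exists>p. awalk u p v \<and> length p = graph_dist G u v"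
    unfolding graph_dist_def by (rule LeastI_ex)
  then show ?thesis using that by blast
qed

lemma graph_dist_neighbour_le:
  assumes uv: "(u, v) \<in> parcs G" and "v \<rightarrow>\<^sup>*\<^bsub>with_proj G\<^esub> s"
  shows "graph_dist G u s \<le> Suc (graph_dist G v s)"
proof -
  obtain p where p: "awalk v p s" "length p = graph_dist G v s" using assms(2) by (rule geodesicE)
  have "awalk u ((u, v) # p) s" using uv p by (simp add: awalk_Cons_iff)
  from graph_dist_le[OF this] show ?thesis using p(2) by simp
qed

text \<open>
  Along a geodesic to \<open>s\<close> the distance to \<open>s\<close> drops at each step, so the only vertex on it that is as
  far from \<open>s\<close> as the start \<open>u\<close>, or farther, is \<open>u\<close>. As the graph has no loops, \<open>v\<close> is not \<open>u\<close>.
\<close>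

lemma geodesic_avoids_farther_neighbour:
  assumes vu: "(v, u) \<in> parcs G" and reach: "u \<rightarrow>\<^sup>*\<^bsub>with_proj G\<^esub> s"
    and le: "graph_dist G u s \<le> graph_dist G v s"
  obtains p where "awalk u p s" "v \<notin> set (awalk_verts u p)"
proof -
  obtain p where p: "awalk u p s" "length p = graph_dist G u s" using reach by (rule geodesicE)
  have "v \<notin> set (awalk_verts u p)"
  proof
    assume "v \<in> set (awalk_verts u p)"
    then obtain q r where qr: "p = q @ r" "awalk u q v" "awalk v r s"
      using awalk_decomp[OF p(1)] by blast
    have "length p \<le> length r" using p(2) le graph_dist_le[OF qr(3)] by linarith
    then have "q = []" using qr(1) by simp
    then have "u = v" using qr(2) by (simp add: awalk_Nil_iff)
    then show False using vu no_loops' by blast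
  qed
  then show ?thesis using p(1) that by blast
qed

text \<open>
  If both neighbours were at most as far from \<open>s\<close> as \<open>v\<close>, their geodesics to \<open>s\<close> would miss \<open>v\<close> and
  join up at \<open>s\<close> to a walk that avoids \<open>v\<close>.
\<close>

lemma geodesic_leaves_through_one_neighbour:
  assumes acyclic: "\<nexists>c. cycle c \<and> 3 \<le> length c"
    and vu: "(v, u) \<in> parcs G" and vw: "(v, w) \<in> parcs G" and "u \<noteq> w"
    and "u \<rightarrow>\<^sup>*\<^bsub>with_proj G\<^esub> s" "w \<rightarrow>\<^sup>*\<^bsub>with_proj G\<^esub> s"
  shows "graph_dist G v s < graph_dist G u s \<or> graph_dist G v s < graph_dist G w s"
proof (rule ccontr)
  assume "\<not> ?thesis"
  then have le: "graph_dist G u s \<le> graph_dist G v s" "graph_dist G w s \<le> graph_dist G v s"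
    by auto
  obtain p where p: "awalk u p s" "v \<notin> set (awalk_verts u p)"
    using vu assms(5) le(1) by (rule geodesic_avoids_farther_neighbour)
  obtain q where q: "awalk w q s" "v \<notin> set (awalk_verts w q)"
    using vw assms(6) le(2) by (rule geodesic_avoids_farther_neighbour)
  have q': "awalk s (rev_path q) w" "v \<notin> set (awalk_verts s (rev_path q))"
    using q awalk_verts_rev_path[OF q(1)] by auto
  have pq: "awalk u (p @ rev_path q) w" using p(1) q'(1) by (rule awalk_appendI)
  have "v \<notin> set (awalk_verts u (p @ rev_path q))"
    using pq p q' by (auto simp: set_awalk_verts_append)
  then show False using cycle_through_two_neighbours[OF vu vw \<open>u \<noteq> w\<close> pq] acyclic by blast
qed

text \<open>
  One distance exceeds \<open>n = graph_dist G v s\<close>, the other is at least \<open>n - 1\<close>, and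
  \<open>(n + 1)\<^sup>2 + (n - 1)\<^sup>2 = 2 * n\<^sup>2 + 2\<close>. The surplus is stated as 1 because for \<open>n = 0\<close> the lower bound
  \<open>n - 1\<close> is truncated to 0; any positive constant makes descents terminate.
\<close>

lemma graph_dist_square_convex:
  assumes acyclic: "\<nexists>c. cycle c \<and> 3 \<le> length c"
    and vu: "(v, u) \<in> parcs G" and vw: "(v, w) \<in> parcs G" and "u \<noteq> w"
    and reach: "u \<rightarrow>\<^sup>*\<^bsub>with_proj G\<^esub> s" "w \<rightarrow>\<^sup>*\<^bsub>with_proj G\<^esub> s"
  shows "2 * (graph_dist G v s)\<^sup>2 + 1 \<le> (graph_dist G u s)\<^sup>2 + (graph_dist G w s)\<^sup>2"
proof -
  let ?n = "graph_dist G v s"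
  have convex: "2 * n\<^sup>2 + 1 \<le> a\<^sup>2 + b\<^sup>2" if "n < a" "n \<le> Suc b" for n a b :: nat
  proof -
    have "(n + 1)\<^sup>2 \<le> a\<^sup>2" "(n - 1)\<^sup>2 \<le> b\<^sup>2" using that by (auto intro!: power_mono)
    \<comment> \<open>At \<open>n = 0\<close> the truncated difference makes this an equality.\<close>
    moreover have "2 * n\<^sup>2 + 1 \<le> (n + 1)\<^sup>2 + (n - 1)\<^sup>2"
      by (cases n) (auto simp: power2_eq_square)
    ultimately show ?thesis by linarith
  qed
  have "?n \<le> Suc (graph_dist G u s)" "?n \<le> Suc (graph_dist G w s)"
    using graph_dist_neighbour_le vu vw reach by blast+
  then show ?thesis
    using geodesic_leaves_through_one_neighbour[OF acyclic vu vw \<open>u \<noteq> w\<close> reach]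
      convex[of ?n "graph_dist G u s" "graph_dist G w s"]
      convex[of ?n "graph_dist G w s" "graph_dist G u s"] by linarith
qed

end

lemma tree_reachable:
  assumes "undirected_tree T" "u \<in> pverts T" "v \<in> pverts T"
  shows "u \<rightarrow>\<^sup>*\<^bsub>with_proj T\<^esub> v"
proof -
  interpret pair_bidirected_digraph T using assms(1) by (simp add: undirected_tree_def)
  have "u \<rightarrow>\<^sup>*\<^bsub>with_proj (mk_symmetric (with_proj T))\<^esub> v"
    using assms by (auto simp: undirected_tree_def connected_def strongly_connected_def)
  then show ?thesis using reachable_mk_symmetric_eq pair_sym_arcs by blast
qed

section \<open>Convexity of the weight function\<close>

lemma infsum_ennreal_pmf_eq_1:
  assumes "set_pmf p \<subseteq> A"
  shows "(\<Sum>\<^sub>\<infinity>s\<in>A. ennreal (pmf p s)) = 1"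
proof -
  have abs: "Infinite_Sum.abs_summable_on (pmf p) A"
    by (metis abs_summable_equivalent pmf_abs_summable)
  then have "(pmf p has_sum infsum (pmf p) A) A"
    using abs_summable_summable has_sum_infsum by blast
  moreover have "infsum (pmf p) A = 1"
    using infsetsum_infsum[of "pmf p" A] infsetsum_pmf_eq_1[OF assms] by (simp add: pmf_abs_summable)
  ultimately have "(pmf p has_sum 1) A" by simp
  then have "((\<lambda>F. ennreal (sum (pmf p) F)) \<longlongrightarrow> ennreal 1) (finite_subsets_at_top A)"
    unfolding has_sum_def by (rule tendsto_ennrealI)
  moreover have "sum (\<lambda>s. ennreal (pmf p s)) = (\<lambda>F. ennreal (sum (pmf p) F))"
    by (simp add: fun_eq_iff)
  ultimately have "((\<lambda>s. ennreal (pmf p s)) has_sum 1) A"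
    by (simp add: has_sum_def)
  then show ?thesis by (rule infsumI)
qed

text \<open>
  Doubling is written as a sum and the constant 1 as the total mass of \<open>\<mu>\<close>, so that both sides are
  sums over the vertices and can be compared term by term. In \<^typ>\<open>ennreal\<close> all sums exist, hence
  finiteness of the weights only enters when passing to real numbers.
\<close>

lemma weight_fn_convex_ennreal:
  assumes tree: "undirected_tree T" and supp: "set_pmf \<mu> \<subseteq> pverts T"
    and vu: "(v, u) \<in> parcs T" and vw: "(v, w) \<in> parcs T" and "u \<noteq> w"
  shows "weight_fn T \<mu> v + weight_fn T \<mu> v + 1 \<le> weight_fn T \<mu> u + weight_fn T \<mu> w"
proof -
  interpret pair_bidirected_digraph T using tree by (simp add: undirected_tree_def)
  let ?d = "\<lambda>x s. real (graph_dist T x s)" and ?V = "pverts T"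
  let ?g = "\<lambda>x s. ennreal ((?d x s)\<^sup>2 * pmf \<mu> s)"
  have sum: "h summable_on ?V" for h :: "_ \<Rightarrow> ennreal"
    by (simp add: nonneg_summable_on_complete)
  have "weight_fn T \<mu> v + weight_fn T \<mu> v + 1
      = (\<Sum>\<^sub>\<infinity>s\<in>?V. ?g v s + ?g v s + ennreal (pmf \<mu> s))"
    by (simp add: weight_fn_def infsum_add[OF sum sum] infsum_ennreal_pmf_eq_1[OF supp])
  also have "\<dots> \<le> (\<Sum>\<^sub>\<infinity>s\<in>?V. ?g u s + ?g w s)"
  proof (rule infsum_mono[OF sum sum])
    fix s assume "s \<in> ?V"
    then have reach: "u \<rightarrow>\<^sup>*\<^bsub>with_proj T\<^esub> s" "w \<rightarrow>\<^sup>*\<^bsub>with_proj T\<^esub> s"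
      using tree_reachable[OF tree] in_arcsD2 vu vw by blast+
    have "2 * (graph_dist T v s)\<^sup>2 + 1 \<le> (graph_dist T u s)\<^sup>2 + (graph_dist T w s)\<^sup>2"
      using graph_dist_square_convex[OF _ vu vw \<open>u \<noteq> w\<close> reach] tree
      by (simp add: undirected_tree_def)
    then have "2 * (?d v s)\<^sup>2 + 1 \<le> (?d u s)\<^sup>2 + (?d w s)\<^sup>2"
      by (metis (mono_tags, lifting) of_nat_1 of_nat_add of_nat_le_iff of_nat_mult of_nat_numeral of_nat_power)
    then have "(2 * (?d v s)\<^sup>2 + 1) * pmf \<mu> s \<le> ((?d u s)\<^sup>2 + (?d w s)\<^sup>2) * pmf \<mu> s"
      by (rule mult_right_mono) simp
    then show "?g v s + ?g v s + ennreal (pmf \<mu> s) \<le> ?g u s + ?g w s"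
      by (simp flip: ennreal_plus add: algebra_simps)
  qed
  also have "\<dots> = weight_fn T \<mu> u + weight_fn T \<mu> w"
    by (simp add: weight_fn_def infsum_add[OF sum sum])
  finally show ?thesis .
qed

lemma weight_fn_eq_ennreal:
  assumes "totally_defined T \<mu>" "v \<in> pverts T"
  shows "weight_fn T \<mu> v = ennreal (enn2real (weight_fn T \<mu> v))"
proof -
  have "weight_fn T \<mu> v < top"
    using assms unfolding totally_defined_def infinity_ennreal_def by blast
  then show ?thesis by simp
qed

lemma weight_fn_convex:
  assumes tree: "undirected_tree T" and supp: "set_pmf \<mu> \<subseteq> pverts T"
    and total: "totally_defined T \<mu>"
    and vu: "(v, u) \<in> parcs T" and vw: "(v, w) \<in> parcs T" and "u \<noteq> w"
  defines "M \<equiv> (\<lambda>v. enn2real (weight_fn T \<mu> v))"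
  shows "2 * M v + 1 \<le> M u + M w"
proof -
  interpret pair_bidirected_digraph T using tree by (simp add: undirected_tree_def)
  have M: "weight_fn T \<mu> x = ennreal (M x) \<and> 0 \<le> M x" if "x \<in> pverts T" for x
    unfolding M_def using weight_fn_eq_ennreal[OF total that] by simp
  have "v \<in> pverts T" "u \<in> pverts T" "w \<in> pverts T"
    using vu vw in_arcsD1 in_arcsD2 by blast+
  note M' = this[THEN M]
  have "ennreal (M v) + ennreal (M v) + 1 \<le> ennreal (M u) + ennreal (M w)"
    using weight_fn_convex_ennreal[OF tree supp vu vw \<open>u \<noteq> w\<close>] M' by simp
  then have "ennreal (M v + M v + 1) \<le> ennreal (M u + M w)"
    using M' by (simp flip: ennreal_1 ennreal_plus)
  moreover have "0 \<le> M u + M w" using M' by simp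
  ultimately have "M v + M v + 1 \<le> M u + M w" by (rule iffD1[OF ennreal_le_iff, rotated])
  then show ?thesis by simp
qed

section \<open>Descent for functions that are convex along paths\<close>

context pair_bidirected_digraph
begin

text \<open>
  Convexity propagates a first step that is not downhill along the whole path: a path does not return
  to the vertex it came from, so two consecutive arcs always lead to distinct neighbours of the middle
  vertex.
\<close>

lemma convex_apath_mono:
  fixes f :: "'a \<Rightarrow> real"
  assumes convex: "\<And>v u w. (v, u) \<in> parcs G \<Longrightarrow> (v, w) \<in> parcs G \<Longrightarrow> u \<noteq> w \<Longrightarrow> 2 * f v \<le> f u + f w"
  shows "apath v (e # p) u \<Longrightarrow> f v \<le> f (snd e) \<Longrightarrow> f v \<le> f u"
proof (induction p arbitrary: v e)
  case Nil
  then show ?case by (auto simp: apath_simps)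
next
  case (Cons e' p)
  obtain x y where e: "e = (v, x)" and e': "e' = (x, y)"
    and arcs: "(v, x) \<in> parcs G" "(x, y) \<in> parcs G"
    using Cons.prems(1) by (cases e; cases e') (auto simp: apath_Cons_iff)
  have path: "apath x (e' # p) u" using Cons.prems(1) e by (auto simp: apath_Cons_iff)
  have "y \<in> set (awalk_verts y p)"
    using path e' hd_in_awalk_verts(2)[of y p u] by (simp add: apath_Cons_iff)
  then have "v \<noteq> y" using Cons.prems(1) e e' by (auto simp: apath_Cons_iff)
  then have "2 * f x \<le> f v + f y" using convex arcs arcs_symmetric by blast
  then have "f x \<le> f y" using Cons.prems(2) e by simp
  then have "f x \<le> f u" using Cons.IH[OF path] e' by simp
  then show ?case using Cons.prems(2) e by simp
qed

lemma convex_local_min_imp_global_min: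
  fixes f :: "'a \<Rightarrow> real"
  assumes convex: "\<And>v u w. (v, u) \<in> parcs G \<Longrightarrow> (v, w) \<in> parcs G \<Longrightarrow> u \<noteq> w \<Longrightarrow> 2 * f v \<le> f u + f w"
    and "\<nexists>u. descent_step G f v u" and reach: "v \<rightarrow>\<^sup>*\<^bsub>with_proj G\<^esub> u"
  shows "f v \<le> f u"
proof -
  obtain p where p: "apath v p u" using reach by (auto simp: reachable_apath)
  show ?thesis
  proof (cases p)
    case Nil
    then show ?thesis using p by (simp add: apath_Nil_iff)
  next
    case (Cons e q)
    then have "(v, snd e) \<in> parcs G" using p by (cases e) (auto simp: apath_Cons_iff)
    then have "f v \<le> f (snd e)" using assms(2) by (auto simp: descent_step_def not_less)
    moreover have "apath v (e # q) u" using p Cons by simp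
    ultimately show ?thesis using convex_apath_mono[of f v e q u] convex by metis
  qed
qed

text \<open>
  The vertex two steps ahead has a smaller value and therefore differs from the current one, so
  convexity applies at every step of a descent and makes the increments \<open>\<delta>\<close> grow by \<open>c\<close> each time.
  In an infinite descent they would become positive.
\<close>

lemma uniformly_convex_descent_terminates:
  fixes f :: "'a \<Rightarrow> real"
  assumes "0 < c"
    and convex: "\<And>v u w. (v, u) \<in> parcs G \<Longrightarrow> (v, w) \<in> parcs G \<Longrightarrow> u \<noteq> w \<Longrightarrow> 2 * f v + c \<le> f u + f w"
  shows "descent_terminates G f v"
  unfolding descent_terminates_def
proof
  assume "\<exists>x. x 0 = v \<and> (\<forall>n. descent_step G f (x n) (x (Suc n)))"
  then obtain x where "\<And>n. descent_step G f (x n) (x (Suc n))" by blast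
  then have arc: "(x n, x (Suc n)) \<in> parcs G" and less: "f (x (Suc n)) < f (x n)" for n
    by (auto simp: descent_step_def)
  define \<delta> where "\<delta> n = f (x (Suc n)) - f (x n)" for n
  have step: "\<delta> n + c \<le> \<delta> (Suc n)" for n
  proof -
    have "x n \<noteq> x (Suc (Suc n))" using less[of n] less[of "Suc n"] by auto
    then have "2 * f (x (Suc n)) + c \<le> f (x n) + f (x (Suc (Suc n)))"
      using convex arc arcs_symmetric by blast
    then show ?thesis by (simp add: \<delta>_def)
  qed
  have increase: "\<delta> 0 + real n * c \<le> \<delta> n" for n
  proof (induction n)
    case (Suc n)
    then show ?case using step[of n] by (simp add: algebra_simps)
  qed simp
  obtain n where "- \<delta> 0 < real n * c" using reals_Archimedean3[OF \<open>0 < c\<close>] by blast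
  then have "0 < \<delta> n" using increase[of n] by linarith
  then show False using less[of n] by (simp add: \<delta>_def)
qed

lemma descent_stays_in_graph:
  assumes "(descent_step G f)\<^sup>*\<^sup>* v w" "v \<in> pverts G"
  shows "w \<in> pverts G"
  using assms by (induction rule: rtranclp_induct) (auto simp: descent_step_def dest: in_arcsD2)

end

text \<open>
  If no reachable vertex is final, dependent choice yields an infinite descent; the predicate \<open>?P\<close>
  also pins down its initial vertex.
\<close>

lemma descent_outputs_nonempty:
  assumes "descent_terminates G f v"
  shows "descent_outputs G f v \<noteq> {}"
proof
  assume empty: "descent_outputs G f v = {}"
  let ?P = "\<lambda>n w. (descent_step G f)\<^sup>*\<^sup>* v w \<and> (n = (0 :: nat) \<longrightarrow> w = v)"
  have "\<exists>x. \<forall>n. ?P n (x n) \<and> descent_step G f (x n) (x (Suc n))"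
  proof (rule dependent_nat_choice)
    fix w n assume "?P n w"
    moreover then obtain u where "descent_step G f w u"
      using empty by (auto simp: descent_outputs_def)
    ultimately show "\<exists>u. ?P (Suc n) u \<and> descent_step G f w u"
      by (auto intro: rtranclp.rtrancl_into_rtrancl)
  qed auto
  then show False using assms unfolding descent_terminates_def by blast
qed

theorem theorem6p4:
  fixes T :: "'a pair_pre_digraph" and \<mu> :: "'a pmf"
  assumes "undirected_tree T"
    and "locally_finite_graph T"
    and "set_pmf \<mu> \<subseteq> pverts T"
    and "totally_defined T \<mu>"
  defines "M \<equiv> (\<lambda>v. enn2real (weight_fn T \<mu> v))"
  shows "\<forall>v\<in>pverts T.
           descent_terminates T M v \<and>
           descent_outputs T M v \<noteq> {} \<and>
           descent_outputs T M v \<subseteq> mean_set T \<mu>"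
proof
  fix v assume v: "v \<in> pverts T"
  interpret pair_bidirected_digraph T using assms(1) by (simp add: undirected_tree_def)
  have convex: "2 * M v + 1 \<le> M u + M w"
    if "(v, u) \<in> parcs T" "(v, w) \<in> parcs T" "u \<noteq> w" for v u w
    unfolding M_def using assms that by (intro weight_fn_convex)
  have terminates: "descent_terminates T M v"
    using convex by (intro uniformly_convex_descent_terminates[where c = 1]) auto
  have "descent_outputs T M v \<subseteq> mean_set T \<mu>"
  proof
    fix w assume "w \<in> descent_outputs T M v"
    then have out: "(descent_step T M)\<^sup>*\<^sup>* v w" "\<nexists>u. descent_step T M w u"
      by (auto simp: descent_outputs_def)
    have w: "w \<in> pverts T" using out(1) v by (rule descent_stays_in_graph)
    have "weight_fn T \<mu> w \<le> weight_fn T \<mu> u" if u: "u \<in> pverts T" for u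
    proof -
      have "M w \<le> M u"
        using convex_local_min_imp_global_min[OF _ out(2) tree_reachable[OF assms(1) w u]] convex
        by force
      moreover have "weight_fn T \<mu> x = ennreal (M x)" if "x \<in> pverts T" for x
        unfolding M_def using assms(4) that by (rule weight_fn_eq_ennreal)
      ultimately show ?thesis using w u by (simp add: ennreal_leI)
    qed
    then show "w \<in> mean_set T \<mu>" using w by (simp add: mean_set_def)
  qed
  then show "descent_terminates T M v \<and> descent_outputs T M v \<noteq> {} \<and>
      descent_outputs T M v \<subseteq> mean_set T \<mu>"
    using terminates descent_outputs_nonempty[OF terminates] by blast
qed

end
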